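(* Let $S=\{s_2,s_1\}\subset\mathbb{N}=\{1,2,\ldots\}$ be a subtraction set with exactly two elements, $s_2<s_1$. Then for every heap size $h\in\mathbb{N}_0$, $$o^1_{\mathrm{FvF}}(h)\ge o^1_{\mathrm{AvA}}(h)\quad\text{and}\quad o^2_{\mathrm{FvF}}(h)\ge o^2_{\mathrm{AvA}}(h).$$ That is, when both players break ties in a friendly manner, each player's PSPE utility is never worse than when both players break ties antagonistically.
   Context: Self-interest cumulative subtraction game: for a finite set $S\subset\mathbb{N}$, there is one heap of $h\in\mathbb{N}_0$ tokens. Two players alternately remove $s\in S$ tokens (with $s\le h$) and add $s$ to their own score. The game ends when the player to move cannot move, i.e. when $h<\min S$. Each player maximizes their own final score. In case of indifference, each player follows a fixed deterministic tie-breaking convention: friendly (F), meaning the player maximizes the opponent's score, or antagonistic (A), meaning the player minimizes it. Let $\tau=\{\mathrm{FvF},\mathrm{FvA},\mathrm{AvF},\mathrm{AvA}\}$. The first letter is the convention of the player to move (player 1) and the second letter is that of the other player (player 2). The dual $\mathsf d$ swaps roles: $\mathsf d(\mathrm{FvF})=\mathrm{FvF}$, $\mathsf d(\mathrm{AvA})=\mathrm{AvA}$, $\mathsf d(\mathrm{AvF})=\mathrm{FvA}$, $\mathsf d(\mathrm{FvA})=\mathrm{AvF}$. Outcomes (PSPE utilities) are defined recursively for $X\in\tau$ as follows. - If $h<\min S$, then $o^1_X(h)=o^2_X(h)=0$. - Otherwise, let $S(h)=S\cap\{1,\ldots,h\}$ and $o^1_X(h)=\max_{s\in S(h)}\big(s+o^2_{\mathsf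 d(X)}(h-s)\big)$. Let $S^*(h)$ be the set of $s\in S(h)$ attaining this maximum. Then $o^2_X(h)=o^1_{\mathsf d(X)}(h-s^* )$, where $s^*$ minimizes $o^1_{\mathsf d(X)}(h-s)$ over $s\in S^*(h)$ if $X\in\{\mathrm{AvF},\mathrm{AvA}\}$, and maximizes it otherwise. *)

theory Defs
  imports Main
begin

text \<open>
  Tie-breaking conventions: the first letter belongs to the player to move, the second letter to
  the other player (F is friendly, A is antagonistic).
\<close>

datatype convention = FvF | FvA | AvF | AvA

fun dual :: "convention \<Rightarrow> convention" where
  "dual FvF = FvF"
| "dual FvA = AvF"
| "dual AvF = FvA"
| "dual AvA = AvA"

definition moves :: "nat set \<Rightarrow> nat \<Rightarrow> nat set" where
  "moves S h = S \<inter> {1..h}"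

text \<open>
  The functions are meant for finite nonempty \<open>S\<close> with \<open>0 \<notin> S\<close>. In \<open>outcome2\<close>, the value
  \<open>outcome1 S (dual X) (h - t)\<close> at an optimal tie-breaking move \<open>t\<close> is written as the minimum
  (maximum) of that expression over the set of score-maximizing moves; it does not depend on which
  optimal move is chosen, see \<open>outcome2_antagonistic\<close> and \<open>outcome2_friendly\<close> below.
\<close>

declare conj_cong [fundef_cong]

function outcome1 :: "nat set \<Rightarrow> convention \<Rightarrow> nat \<Rightarrow> nat"
  and outcome2 :: "nat set \<Rightarrow> convention \<Rightarrow> nat \<Rightarrow> nat" where
  "outcome1 S X h =
    (if h < Min S then 0
     else Max ((\<lambda>s. s + outcome2 S (dual X) (h - s)) ` moves S h))"
| "outcome2 S X h =
    (if h < Min S then 0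
     else let best = {s. s \<in> moves S h \<and> s + outcome2 S (dual X) (h - s) = outcome1 S X h}
          in if X \<in> {AvF, AvA}
             then Min ((\<lambda>s. outcome1 S (dual X) (h - s)) ` best)
             else Max ((\<lambda>s. outcome1 S (dual X) (h - s)) ` best))"
  by pat_completeness auto
termination
  by (relation "measure (case_sum (\<lambda>(S, X, h). 2 * h) (\<lambda>(S, X, h). 2 * h + 1))")
    (auto simp: moves_def)

declare conj_cong [fundef_cong del]

declare outcome1.simps [simp del] outcome2.simps [simp del]

definition best_moves :: "nat set \<Rightarrow> convention \<Rightarrow> nat \<Rightarrow> nat set" where
  "best_moves S X h =
    {s \<in> moves S h. s + outcome2 S (dual X) (h - s) = outcome1 S X h}"

lemma finite_best_moves: "finite (best_moves S X h)"
  by (auto simp: best_moves_def moves_def)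

lemma best_moves_nonempty:
  assumes "finite S" "S \<noteq> {}" "0 \<notin> S" "Min S \<le> h"
  shows "best_moves S X h \<noteq> {}"
proof -
  let ?f = "\<lambda>s. s + outcome2 S (dual X) (h - s)"
  have "Min S \<in> S" using assms by simp
  with assms have "Min S \<in> moves S h"
    by (auto simp: moves_def Suc_le_eq intro: gr0I)
  then have "Max (?f ` moves S h) \<in> ?f ` moves S h"
    by (intro Max_in) (auto simp: moves_def)
  moreover have "outcome1 S X h = Max (?f ` moves S h)"
    using assms(4) by (subst outcome1.simps) (simp del: Min_le_iff Min_gr_iff add: not_less[symmetric])
  ultimately show ?thesis
    by (auto simp: best_moves_def)
qed

lemma outcome2_antagonistic:
  assumes "Min S \<le> h" "X \<in> {AvF, AvA}" "t \<in> best_moves S X h"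
    and "\<And>s. s \<in> best_moves S X h \<Longrightarrow> outcome1 S (dual X) (h - t) \<le> outcome1 S (dual X) (h - s)"
  shows "outcome2 S X h = outcome1 S (dual X) (h - t)"
proof -
  have "outcome2 S X h = Min ((\<lambda>s. outcome1 S (dual X) (h - s)) ` best_moves S X h)"
    using assms(1,2) by (subst outcome2.simps) (auto simp: best_moves_def Let_def)
  also have "\<dots> = outcome1 S (dual X) (h - t)"
    using assms(3,4) by (intro Min_eqI) (auto simp: finite_best_moves)
  finally show ?thesis .
qed

lemma outcome2_friendly:
  assumes "Min S \<le> h" "X \<notin> {AvF, AvA}" "t \<in> best_moves S X h"
    and "\<And>s. s \<in> best_moves S X h \<Longrightarrow> outcome1 S (dual X) (h - s) \<le> outcome1 S (dual X) (h - t)"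
  shows "outcome2 S X h = outcome1 S (dual X) (h - t)"
proof -
  have "outcome2 S X h = Max ((\<lambda>s. outcome1 S (dual X) (h - s)) ` best_moves S X h)"
    using assms(1,2) by (subst outcome2.simps) (auto simp: best_moves_def Let_def)
  also have "\<dots> = outcome1 S (dual X) (h - t)"
    using assms(3,4) by (intro Max_eqI) (auto simp: finite_best_moves)
  finally show ?thesis .
qed

end

theory Submission
  imports Defs
begin

text \<open>
  Write \<open>p < q = p + d\<close> for the two moves. When both players are antagonistic, the opponent of the
  mover never gets more than \<open>outcome1 (h - q)\<close>, i.e. than if the mover had taken \<open>q\<close>. When both
  are friendly, both outcomes are monotone along steps of length \<open>d\<close>; as \<open>h - p = (h - q) + d\<close>, the
  opponent gets at least \<open>outcome1 (h - q)\<close>. The comparison is then an induction on the heap.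

  The antagonistic bound is clear unless \<open>p\<close> is strictly better than \<open>q\<close> for the mover. This never
  happens if \<open>q \<ge> 2 p\<close>. If \<open>q < 2 p\<close>, the antagonistic outcomes are values of the knapsack problem
  with items of value \<open>q\<close>, weight \<open>2 q\<close> and of value \<open>p\<close>, weight \<open>p + q\<close> (each move of the mover
  is answered by \<open>q\<close>), and the bound becomes an exchange argument for this problem.
\<close>

section \<open>Outcomes unfolded for two moves\<close>

locale two_moves =
  fixes p d :: nat
  assumes p_pos: "0 < p" and d_pos: "0 < d"
begin

abbreviation q :: nat where "q \<equiv> p + d"

abbreviation o1 :: "convention \<Rightarrow> nat \<Rightarrow> nat" where "o1 \<equiv> outcome1 {p, q}"

abbreviation o2 :: "convention \<Rightarrow> nat \<Rightarrow> nat" where "o2 \<equiv> outcome2 {p, q}"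

lemma Min_moves: "Min {p, q} = p"
  by (intro Min_eqI) auto

lemma moves_medium: "p \<le> h \<Longrightarrow> h < q \<Longrightarrow> moves {p, q} h = {p}"
  using p_pos by (auto simp: moves_def)

lemma moves_large: "q \<le> h \<Longrightarrow> moves {p, q} h = {p, q}"
  using p_pos by (auto simp: moves_def)

lemma o1_small: "h < p \<Longrightarrow> o1 X h = 0"
  by (subst outcome1.simps, subst Min_moves) simp

lemma o2_small: "h < p \<Longrightarrow> o2 X h = 0"
  by (subst outcome2.simps, subst Min_moves) simp

lemma o1_medium: "p \<le> h \<Longrightarrow> h < q \<Longrightarrow> o1 X h = p + o2 (dual X) (h - p)"
  by (subst outcome1.simps, subst Min_moves) (simp add: moves_medium)

lemma o1_large:
  assumes "q \<le> h"
  shows "o1 X h = max (p + o2 (dual X) (h - p)) (q + o2 (dual X) (h - q))"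
  using assms by (subst outcome1.simps, subst Min_moves) (simp add: moves_large)

lemma o2_medium:
  assumes "p \<le> h" "h < q"
  shows "o2 X h = o1 (dual X) (h - p)"
proof -
  have "{s. s \<in> moves {p, q} h \<and> s + o2 (dual X) (h - s) = o1 X h} = {p}"
    using assms by (auto simp: moves_medium o1_medium)
  then show ?thesis
    using assms by (subst outcome2.simps, subst Min_moves) (simp add: Let_def)
qed

lemma o2_large:
  assumes "q \<le> h"
  shows "o2 X h =
    (let P = p + o2 (dual X) (h - p); Q = q + o2 (dual X) (h - q);
         u = o1 (dual X) (h - p); v = o1 (dual X) (h - q)
     in if Q < P then u else if P < Q then v
        else if X \<in> {AvF, AvA} then min u v else max u v)"
proof -
  let ?P = "p + o2 (dual X) (h - p)" and ?Q = "q + o2 (dual X) (h - q)"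
  have best: "{s. s \<in> moves {p, q} h \<and> s + o2 (dual X) (h - s) = o1 X h} =
      (if ?Q < ?P then {p} else if ?P < ?Q then {q} else {p, q})"
    using assms by (auto simp: moves_large o1_large)
  show ?thesis
    using assms by (subst outcome2.simps, subst Min_moves) (simp add: best Let_def)
qed

text \<open>\<open>q\<close> from \<open>x + d\<close> and \<open>p\<close> from \<open>x\<close>
  lead to the same heap \<open>x - p\<close>; the inductions along steps of length \<open>d\<close>
  rest on this.\<close>

lemma o1_shift:
  "p \<le> x \<Longrightarrow> o1 X (x + d) = max (p + o2 (dual X) (x - p + d)) (q + o2 (dual X) (x - p))"
  by (simp add: o1_large[of "x + d"])

lemma o2_shift:
  "p \<le> x \<Longrightarrow> o2 X (x + d) =
    (let P = p + o2 (dual X) (x - p + d); Q = q + o2 (dual X) (x - p);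
         u = o1 (dual X) (x - p + d); v = o1 (dual X) (x - p)
     in if Q < P then u else if P < Q then v
        else if X \<in> {AvF, AvA} then min u v else max u v)"
  by (simp add: o2_large[of "x + d"])

section \<open>Growth of outcomes along steps of length \<open>d\<close>\<close>

text \<open>For \<open>o2\<close>, the value \<open>o1 X (x - p)\<close> separates the two sides:
  every move from \<open>x\<close> leaves the opponent at most that, every move from
  \<open>x + d\<close> at least that. For \<open>o1\<close>, taking \<open>q\<close> from
  \<open>x + d\<close> already earns enough.\<close>

lemma step_mono:
  assumes "dual X = X"
  shows "o1 X x \<le> o1 X (x + d) \<and> o2 X x \<le> o2 X (x + d)"
proof (induction x rule: less_induct)
  case (less x)
  consider "x < p" | "p \<le> x" "x < q" | "q \<le> x" by linarith
  then show ?case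
  proof cases
    case 1
    then show ?thesis by (simp add: o1_small o2_small)
  next
    case 2
    have "o1 X (x - p) \<le> o1 X (x - p + d)"
      using less[of "x - p"] 2 p_pos by simp
    then show ?thesis
      unfolding o1_medium[OF 2] o2_medium[OF 2] o1_shift[OF 2(1)] o2_shift[OF 2(1)] assms Let_def
      by auto
  next
    case 3
    then have "p \<le> x" by simp
    have "o1 X (x - p) \<le> o1 X (x - p + d)"
      using less[of "x - p"] 3 p_pos by simp
    moreover have "o1 X (x - q) \<le> o1 X (x - p)" "o2 X (x - q) \<le> o2 X (x - p)"
      using less[of "x - q"] 3 p_pos by simp_all
    ultimately show ?thesis
      unfolding o1_large[OF 3] o2_large[OF 3] o1_shift[OF \<open>p \<le> x\<close>] o2_shift[OF \<open>p \<le> x\<close>] assms Let_def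
      by auto
  qed
qed

lemma outcomes_le: "o1 X h \<le> h \<and> o2 X h \<le> h - p"
proof (induction h arbitrary: X rule: less_induct)
  case (less h)
  consider "h < p" | "p \<le> h" "h < q" | "q \<le> h" by linarith
  then show ?case
  proof cases
    case 1
    then show ?thesis by (simp add: o1_small o2_small)
  next
    case 2
    then show ?thesis
      unfolding o1_medium[OF 2] o2_medium[OF 2]
      using less[of "h - p" "dual X"] p_pos 2 by auto
  next
    case 3
    then have "h - p < h" "h - q < h" using p_pos by simp_all
    from less[OF this(1), of "dual X"] less[OF this(2), of "dual X"] 3
    have "p + o2 (dual X) (h - p) \<le> h" "q + o2 (dual X) (h - q) \<le> h"
      "o1 (dual X) (h - p) \<le> h - p" "o1 (dual X) (h - q) \<le> h - p"
      by linarith+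
    then show ?thesis
      unfolding o1_large[OF 3] o2_large[OF 3] Let_def by (simp add: min_le_iff_disj)
  qed
qed

text \<open>Since \<open>h - p = (h - q) + d\<close>, the bound on \<open>o2\<close> means that
  \<open>p\<close> never beats \<open>q\<close> strictly. Inductively \<open>q\<close> is thus a
  best move from \<open>x + d\<close> when \<open>p \<le> x\<close>, and antagonism leaves the
  opponent at most \<open>o1 AvA (x - p)\<close>.\<close>

lemma AvA_step_le:
  assumes "p \<le> d"
  shows "o1 AvA (x + d) \<le> o1 AvA x + d \<and> o2 AvA (x + d) \<le> o2 AvA x + d"
proof (induction x rule: less_induct)
  case (less x)
  consider "x < p" | "p \<le> x" "x < q" | "q \<le> x" by linarith
  then show ?case
  proof cases
    case 1
    have "o1 AvA (x + d) = p + o2 AvA (x + d - p)"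
      using 1 assms by (simp add: o1_medium)
    \<comment> \<open>The bound obtained is \<open>max p (x + d - p)\<close>: a reply is either
      impossible or takes at least \<open>p\<close>.\<close>
    then have "o1 AvA (x + d) \<le> d"
      using outcomes_le[of AvA "x + d - p"] 1 assms by linarith
    moreover have "o2 AvA (x + d) \<le> d"
      using outcomes_le[of AvA "x + d"] 1 by linarith
    ultimately show ?thesis by simp
  next
    case 2
    have "o2 AvA (x - p + d) \<le> o2 AvA (x - p) + d"
      using less[of "x - p"] 2 p_pos by simp
    then show ?thesis
      unfolding o1_medium[OF 2] o2_medium[OF 2] o1_shift[OF 2(1)] o2_shift[OF 2(1)] dual.simps Let_def
      by auto
  next
    case 3
    then have "p \<le> x" by simp
    have "o2 AvA (x - p + d) \<le> o2 AvA (x - p) + d"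
      using less[of "x - p"] 3 p_pos by simp
    moreover have "o1 AvA (x - p) \<le> o1 AvA (x - q) + d" "o2 AvA (x - p) \<le> o2 AvA (x - q) + d"
      using less[of "x - q"] 3 p_pos by simp_all
    moreover have "o1 AvA (x - q) \<le> o1 AvA (x - p)"
      using step_mono[of AvA "x - q"] 3 by simp
    ultimately show ?thesis
      unfolding o1_large[OF 3] o2_large[OF 3] o1_shift[OF \<open>p \<le> x\<close>] o2_shift[OF \<open>p \<le> x\<close>]
        dual.simps Let_def
      by (auto simp: min_le_iff_disj)
  qed
qed

section \<open>The knapsack problem\<close>

definition packings :: "nat \<Rightarrow> (nat \<times> nat) set" where
  "packings n = {(i, j). 2 * q * i + (p + q) * j \<le> n}"

definition knapsack :: "nat \<Rightarrow> nat" where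
  "knapsack n = Max ((\<lambda>(i, j). q * i + p * j) ` packings n)"

lemma finite_packings: "finite (packings n)"
proof (rule finite_subset)
  show "packings n \<subseteq> {..n} \<times> {..n}"
  proof clarify
    fix i j assume "(i, j) \<in> packings n"
    then have "2 * q * i + (p + q) * j \<le> n"
      unfolding packings_def by blast
    moreover have "i \<le> 2 * q * i" "j \<le> (p + q) * j"
      using p_pos by simp_all
    ultimately show "i \<in> {..n} \<and> j \<in> {..n}"
      unfolding atMost_iff by linarith
  qed
qed simp

lemma knapsack_ge:
  assumes "2 * q * i + (p + q) * j \<le> n"
  shows "q * i + p * j \<le> knapsack n"
proof -
  have "(i, j) \<in> packings n"
    using assms by (simp add: packings_def)
  then have "(case (i, j) of (i, j) \<Rightarrow> q * i + p * j) \<le> knapsack n"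
    unfolding knapsack_def by (intro Max_ge finite_imageI finite_packings imageI)
  then show ?thesis by simp
qed

lemma knapsack_obtain:
  obtains i j where "2 * q * i + (p + q) * j \<le> n" "knapsack n = q * i + p * j"
proof -
  have "(0, 0) \<in> packings n"
    by (simp add: packings_def)
  then have "knapsack n \<in> (\<lambda>(i, j). q * i + p * j) ` packings n"
    unfolding knapsack_def by (intro Max_in) (auto simp: finite_packings)
  then show thesis
    using that by (auto simp: packings_def)
qed

lemma knapsack_mono: "m \<le> n \<Longrightarrow> knapsack m \<le> knapsack n"
  by (metis knapsack_ge knapsack_obtain le_trans)

lemma knapsack_0:
  assumes "n < p + q"
  shows "knapsack n = 0"
proof (rule knapsack_obtain[of n])
  fix i j assume ij: "2 * q * i + (p + q) * j \<le> n" "knapsack n = q * i + p * j"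
  have "i = 0" "j = 0"
    using ij(1) assms by (cases i; cases j; simp)+
  with ij show ?thesis by simp
qed

text \<open>For \<open>n = h + q\<close> this is the range \<open>p \<le> h < q\<close>, where
  \<open>p\<close> is the only move.\<close>

lemma knapsack_p:
  assumes "p + q \<le> n" "n < 2 * q"
  shows "knapsack n = p"
proof (rule antisym)
  show "knapsack n \<le> p"
  proof (rule knapsack_obtain[of n])
    fix i j assume ij: "2 * q * i + (p + q) * j \<le> n" "knapsack n = q * i + p * j"
    have "i = 0" using ij(1) assms(2) by (cases i) simp_all
    then have "(p + q) * j \<le> n" using ij(1) by simp
    have "j < 2"
    proof (rule ccontr)
      assume "\<not> j < 2"
      then have "(p + q) * 2 \<le> (p + q) * j" by (intro mult_le_mono2) simp
      with \<open>(p + q) * j \<le> n\<close> have "(p + q) * 2 \<le> n" by (rule le_trans[rotated])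
      with assms(2) show False by simp
    qed
    with \<open>i = 0\<close> ij(2) show ?thesis by (auto simp: numeral_2_eq_2 less_Suc_eq)
  qed
  show "p \<le> knapsack n"
    using knapsack_ge[of 0 1 n] assms by simp
qed

text \<open>Split by one packed item. For \<open>n = h + q\<close> the remaining capacities are
  \<open>h - p\<close> and \<open>h - q\<close>, matching \<open>o1_large\<close>.\<close>

lemma knapsack_rec:
  assumes "2 * q \<le> n"
  shows "knapsack n = max (p + knapsack (n - (p + q))) (q + knapsack (n - 2 * q))"
proof (rule antisym)
  show "knapsack n \<le> max (p + knapsack (n - (p + q))) (q + knapsack (n - 2 * q))"
  proof (rule knapsack_obtain[of n])
    fix i j assume ij: "2 * q * i + (p + q) * j \<le> n" "knapsack n = q * i + p * j"
    show ?thesis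
    proof (cases i)
      case (Suc i')
      then have "q * i' + p * j \<le> knapsack (n - 2 * q)"
        using ij(1) by (intro knapsack_ge) (simp add: algebra_simps)
      then show ?thesis using ij Suc by simp
    next
      case 0
      show ?thesis
      proof (cases j)
        case (Suc j')
        then have "q * i + p * j' \<le> knapsack (n - (p + q))"
          using ij(1) by (intro knapsack_ge) (simp add: algebra_simps)
        then show ?thesis using ij Suc by simp
      qed (use ij 0 in simp)
    qed
  qed
  have "p + knapsack (n - (p + q)) \<le> knapsack n"
  proof (rule knapsack_obtain[of "n - (p + q)"])
    fix i j
    assume ij: "2 * q * i + (p + q) * j \<le> n - (p + q)" "knapsack (n - (p + q)) = q * i + p * j"
    have "p + q \<le> n" using assms by simp
    with ij(1) have "2 * q * i + (p + q) * Suc j \<le> n"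
      unfolding mult_Suc_right by linarith
    from knapsack_ge[OF this] ij(2) show ?thesis by simp
  qed
  moreover have "q + knapsack (n - 2 * q) \<le> knapsack n"
  proof (rule knapsack_obtain[of "n - 2 * q"])
    fix i j
    assume ij: "2 * q * i + (p + q) * j \<le> n - 2 * q" "knapsack (n - 2 * q) = q * i + p * j"
    with assms have "2 * q * Suc i + (p + q) * j \<le> n"
      unfolding mult_Suc_right by linarith
    from knapsack_ge[OF this] ij(2) show ?thesis by simp
  qed
  ultimately show "max (p + knapsack (n - (p + q))) (q + knapsack (n - 2 * q)) \<le> knapsack n"
    by simp
qed

text \<open>
  Exchanging an item of value \<open>q\<close> for one of value \<open>p\<close> frees weight \<open>d\<close> and loses value \<open>d\<close>. Hence
  after a jump by more than \<open>d\<close> the optimum consists of \<open>j\<close> items of value \<open>p\<close> only, and \<open>j\<close> is so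
  small that capacity \<open>x + q\<close> already suffices to make all of them items of value \<open>q\<close>.
\<close>

lemma knapsack_jump:
  assumes "d < p" and jump: "knapsack x + d < knapsack (x + d)"
  shows "knapsack (x + d + q) = knapsack (x + q)"
proof -
  obtain i j where ij: "2 * q * i + (p + q) * j \<le> x + d" "knapsack (x + d) = q * i + p * j"
    by (rule knapsack_obtain)
  have "i = 0"
  proof (rule ccontr)
    assume "i \<noteq> 0"
    then obtain i' where "i = Suc i'" by (cases i) auto
    then show False
      using knapsack_ge[of i' "Suc j" x] ij jump by (simp add: algebra_simps)
  qed
  with ij have fit: "(p + q) * j \<le> x + d" and val: "knapsack (x + d) = p * j"
    by simp_all
  have tight: "x < (p + q) * j"
    using knapsack_ge[of 0 j x] val jump by (cases "(p + q) * j \<le> x") simp_all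
  then obtain j' where j': "j = Suc j'" by (cases j) auto
  have "d * j < p"
  proof (rule ccontr)
    assume "\<not> d * j < p"
    \<comment> \<open>Drop one item of value \<open>p\<close> and upgrade \<open>k\<close> others to
      value \<open>q\<close>. Minimality keeps the added weight \<open>d * k\<close> below
      \<open>p\<close>, so the result fits into \<open>x\<close>; \<open>p \<le> d * Suc k\<close>
      limits the loss to \<open>d\<close>, against the jump.\<close>
    define k where "k = (LEAST k. p \<le> d * Suc k)"
    have large: "p \<le> d * Suc k" and least: "k \<le> j'"
      using \<open>\<not> d * j < p\<close> unfolding j' k_def not_less by (rule LeastI Least_le)+
    have "d * k < p"
    proof (cases k)
      case (Suc k')
      then show ?thesis
        using not_less_Least[of k' "\<lambda>k. p \<le> d * Suc k"] unfolding k_def by simp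
    qed (use p_pos in simp)
    obtain m where m: "j' = k + m"
      using least by (auto simp: le_iff_add)
    have "q * k + p * m \<le> knapsack x"
    proof (rule knapsack_ge)
      have "2 * q * k + (p + q) * m = (p + q) * j' + d * k"
        unfolding m by (simp add: algebra_simps)
      then show "2 * q * k + (p + q) * m \<le> x"
        using fit \<open>d * k < p\<close> unfolding j' by simp
    qed
    moreover have "q * k + p * m = p * j' + d * k"
      unfolding m by (simp add: algebra_simps)
    ultimately show False
      using large jump unfolding val j' by simp
  qed
  \<comment> \<open>Upgrading all \<open>j\<close> items adds weight \<open>d * j < p\<close>, and
    \<open>x + d + p = x + q\<close>.\<close>
  then have "2 * q * j \<le> x + q"
    using fit by (simp add: algebra_simps)
  then have lower: "q * j \<le> knapsack (x + q)"
    using knapsack_ge[of j 0 "x + q"] by simp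
  \<comment> \<open>Every item weighs at least \<open>p + q\<close>, and \<open>d < p\<close> puts
    the capacity below \<open>(p + q) * Suc j\<close>; so at most \<open>j\<close> items
    fit.\<close>
  have "knapsack (x + d + q) \<le> q * j"
  proof (rule knapsack_obtain[of "x + d + q"])
    fix m n assume mn: "2 * q * m + (p + q) * n \<le> x + d + q" "knapsack (x + d + q) = q * m + p * n"
    have "(p + q) * (m + n) < (p + q) * Suc j"
      using mn(1) tight assms(1) by (simp add: algebra_simps)
    then have "m + n \<le> j" by (simp only: mult_less_cancel1 less_Suc_eq_le)
    then have "q * (m + n) \<le> q * j" by (rule mult_le_mono2)
    with mn(2) show ?thesis by (simp add: algebra_simps)
  qed
  with lower show ?thesis
    using knapsack_mono[of "x + q" "x + d + q"] by simp
qed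

section \<open>Antagonistic outcomes as knapsack values\<close>

text \<open>The mover's extra capacity \<open>q\<close> pays for the answer to the last move, which
  need not fit into the heap.\<close>

lemma AvA_eq_knapsack:
  assumes "d < p"
  shows "o1 AvA h = knapsack (h + q) \<and> o2 AvA h = knapsack h"
proof (induction h rule: less_induct)
  case (less h)
  consider "h < p" | "p \<le> h" "h < q" | "q \<le> h" by linarith
  then show ?case
  proof cases
    case 1
    then show ?thesis by (simp add: o1_small o2_small knapsack_0)
  next
    case 2
    with assms show ?thesis
      by (simp add: o1_medium o2_medium o1_small o2_small knapsack_0 knapsack_p)
  next
    case 3
    define x where "x = h - q"
    have h: "h = x + q" using 3 by (simp add: x_def)
    have IH: "o1 AvA x = knapsack (x + q)" "o2 AvA x = knapsack x"
      "o1 AvA (x + d) = knapsack (x + d + q)" "o2 AvA (x + d) = knapsack (x + d)"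
      using less[of x] less[of "x + d"] h p_pos by simp_all
    have diffs: "h - p = x + d" "h - q = x" by (simp_all add: h)
    note o_h = o1_large[OF 3, of AvA, unfolded dual.simps diffs IH]
      o2_large[OF 3, of AvA, unfolded dual.simps diffs IH]
    have "h + q - (p + q) = x + d" "h + q - 2 * q = x"
      by (simp_all add: h)
    then have "o1 AvA h = knapsack (h + q)"
      using knapsack_rec[of "h + q"] 3 o_h(1) by simp
    \<comment> \<open>A strict preference for \<open>p\<close> is exactly the jump, and then both
      moves leave the opponent the same. Otherwise the opponent gets the value after
      \<open>q\<close>, the smaller one by monotonicity.\<close>
    moreover have "o2 AvA h = knapsack h"
      using knapsack_jump[OF assms, of x] knapsack_mono[of "x + q" "x + d + q"] o_h(2)
      by (auto simp: h Let_def)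
    ultimately show ?thesis by simp
  qed
qed

section \<open>Comparison of the two conventions\<close>

text \<open>For \<open>d < p\<close> both sides equal \<open>knapsack h\<close>. Otherwise
  \<open>q\<close> is a best move, and the antagonistic choice leaves the opponent no more than
  \<open>q\<close> does.\<close>

lemma o2_AvA_le:
  assumes "q \<le> h"
  shows "o2 AvA h \<le> o1 AvA (h - q)"
proof (cases "d < p")
  case True
  with assms show ?thesis
    by (simp add: AvA_eq_knapsack)
next
  case False
  then have "o2 AvA (h - p) \<le> o2 AvA (h - q) + d"
    using AvA_step_le[of "h - q"] assms by simp
  then show ?thesis
    unfolding o2_large[OF assms] dual.simps Let_def by auto
qed

lemma o2_FvF_ge:
  assumes "q \<le> h"
  shows "o1 FvF (h - q) \<le> o2 FvF h"
  using step_mono[of FvF "h - q"] assms unfolding o2_large[OF assms] dual.simps Let_def by auto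

lemma AvA_le_FvF: "o1 AvA h \<le> o1 FvF h \<and> o2 AvA h \<le> o2 FvF h"
proof (induction h rule: less_induct)
  case (less h)
  consider "h < p" | "p \<le> h" "h < q" | "q \<le> h" by linarith
  then show ?case
  proof cases
    case 1
    then show ?thesis by (simp add: o1_small o2_small)
  next
    case 2
    then show ?thesis
      using less[of "h - p"] p_pos by (simp add: o1_medium o2_medium)
  next
    case 3
    have "o2 AvA (h - p) \<le> o2 FvF (h - p)"
      and "o1 AvA (h - q) \<le> o1 FvF (h - q)" "o2 AvA (h - q) \<le> o2 FvF (h - q)"
      using less[of "h - p"] less[of "h - q"] 3 p_pos by simp_all
    \<comment> \<open>For \<open>o2\<close> the chain is \<open>o2 AvA h \<le> o1 AvA (h - q) \<le>
      o1 FvF (h - q) \<le> o2 FvF h\<close>; for \<open>o1\<close> the two options are compared one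
      by one.\<close>
    then show ?thesis
      using o2_AvA_le[OF 3] o2_FvF_ge[OF 3] unfolding o1_large[OF 3] dual.simps
      by (auto simp: le_max_iff_disj)
  qed
qed

end

theorem theorem1:
  fixes s1 s2 h :: nat
  assumes "0 < s2" and "s2 < s1"
  shows "outcome1 {s2, s1} FvF h \<ge> outcome1 {s2, s1} AvA h
       \<and> outcome2 {s2, s1} FvF h \<ge> outcome2 {s2, s1} AvA h"
proof -
  interpret two_moves s2 "s1 - s2"
    using assms by unfold_locales simp_all
  show ?thesis
    using AvA_le_FvF[of h] assms by simp
qed

end
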